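(* Let $G=(V,E)$ be a finite or locally finite weighted graph with edge weights $w_{xy}$ and measure $\mu$, and suppose $D_\mu=\sup_{x\in V}\deg(x)/\mu(x)<+\infty$, $\mu_{\max}=\sup_{x\in V}\mu(x)<+\infty$ and $w_{\min}=\inf_{x\in V,\,y\sim x}w_{xy}>0$. Suppose that $w_{xy}=w_{yx}$ for all $x,y\in V$ with $y\sim x$. Let $p(t,x,y)$ be the heat kernel on $G$. Then: $(i)$ For any $t>0$, $x\in V$ and $y\in V$, $$p(t,x,y)\leq\frac{1}{{\rm Vol}(B(x,\sqrt{t}))}\exp\left\{4\sqrt{\frac{2D_\mu\mu_{\max}}{w_{\min}}t}\right\}.$$ $(ii)$ If, in addition, $\mu(x)=\deg(x)$ for all $x\in V$, then for any $t>0$, $x\in V$ and $y\in V$, $$p(t,x,y)\geq\frac{1}{\deg(y)}\exp\left\{-2t-\frac{4\mu_{\max}}{w_{\min}}\frac{({\rm dist}(x,y))^2}{t}\right\}.$$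
   Context: $G=(V,E)$ is a finite or locally finite graph (every vertex has finitely many neighbours) with vertex set $V$ and edge set $E$. We write $y\sim x$ if $y$ is adjacent to $x$, i.e. $xy\in E$. Each edge $xy\in E$ has a weight $w_{xy}>0$. The degree of $x\in V$ is $\deg(x)=\sum_{y\sim x}w_{xy}$. $\mu$ is a measure on $V$ with $0<\mu(x)<\infty$ for each $x\in V$. The $\mu$-Laplacian of $f:V\to\mathbb{R}$ is $$\Delta f(x)=\frac{1}{\mu(x)}\sum_{y\sim x}w_{xy}(f(y)-f(x)).$$ When $D_\mu<+\infty$, $\Delta$ is a bounded operator on $\ell^\infty(V)$. The heat kernel $p(t,x,y)$, $t>0$, is the fundamental solution of the heat equation $\Delta u=\partial_t u$ with respect to $\mu$: for every bounded $u_0:V\to\mathbb{R}$, the function $u(x,t)=\sum_{y\in V}\mu(y)p(t,x,y)u_0(y)$ is the bounded solution of $\Delta u=\partial_t u$ for $t>0$ with $\lim_{t\to0+}u(x,t)=u_0(x)$; equivalently $p(t,x,y)=\frac{1}{\mu(y)}(e^{t\Delta}\delta_y)(x)$, where $\delta_y$ is the indicator function of $\{y\}$. ${\rm dist}(x,y)$ is the number of edges in a shortest path from $x$ to $y$; if there is no path, ${\rm dist}(x,y)=+\infty$ and the right-hand side in $(ii)$ is $0$. $B(x,r)=\{z\in V:{\rm dist}(x,z)<r\}$ and ${\rm Vol}(B(x,r))=\sum_{z\in B(x,r)}\mu(z)$. *)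

theory Defs
  imports "HOL-Analysis.Analysis"
begin

text \<open>
  An edge \<open>xy\<close> is the unordered pair \<open>{x, y}\<close>; loops \<open>{x}\<close> are not excluded and connectedness is
  not required. The weight \<open>w x y\<close> is a priori allowed to depend on the orientation of the edge;
  its values off the edges play no role.
\<close>

definition nbrs :: "'a set set \<Rightarrow> 'a \<Rightarrow> 'a set" where
  "nbrs E x = {y. {x, y} \<in> E}"

locale weighted_graph =
  fixes V :: "'a set" and E :: "'a set set" and w :: "'a \<Rightarrow> 'a \<Rightarrow> real" and \<mu> :: "'a \<Rightarrow> real"
  assumes edges: "e \<in> E \<Longrightarrow> \<exists>x\<in>V. \<exists>y\<in>V. e = {x, y}"
    and locally_finite: "x \<in> V \<Longrightarrow> finite (nbrs E x)"
    and weight_pos: "{x, y} \<in> E \<Longrightarrow> w x y > 0"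
    and measure_pos: "x \<in> V \<Longrightarrow> \<mu> x > 0"

definition wdeg :: "'a set set \<Rightarrow> ('a \<Rightarrow> 'a \<Rightarrow> real) \<Rightarrow> 'a \<Rightarrow> real" where
  "wdeg E w x = (\<Sum>y\<in>nbrs E x. w x y)"

definition laplacian ::
  "'a set set \<Rightarrow> ('a \<Rightarrow> 'a \<Rightarrow> real) \<Rightarrow> ('a \<Rightarrow> real) \<Rightarrow> ('a \<Rightarrow> real) \<Rightarrow> 'a \<Rightarrow> real" where
  "laplacian E w \<mu> f x = 1 / \<mu> x * (\<Sum>y\<in>nbrs E x. w x y * (f y - f x))"

text \<open>
  The suprema and the infimum are taken in the extended reals, so that their finiteness and
  positivity are meaningful hypotheses. For a graph without edges \<open>w_min\<close> is \<open>\<infinity>\<close>; then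
  \<open>real_of_ereal w_min = 0\<close> and a quotient by it is \<open>0\<close>, in agreement with \<open>1 / \<infinity> = 0\<close>.
\<close>

definition D_mu ::
  "'a set \<Rightarrow> 'a set set \<Rightarrow> ('a \<Rightarrow> 'a \<Rightarrow> real) \<Rightarrow> ('a \<Rightarrow> real) \<Rightarrow> ereal" where
  "D_mu V E w \<mu> = (SUP x\<in>V. ereal (wdeg E w x / \<mu> x))"

definition mu_max :: "'a set \<Rightarrow> ('a \<Rightarrow> real) \<Rightarrow> ereal" where
  "mu_max V \<mu> = (SUP x\<in>V. ereal (\<mu> x))"

definition w_min :: "'a set \<Rightarrow> 'a set set \<Rightarrow> ('a \<Rightarrow> 'a \<Rightarrow> real) \<Rightarrow> ereal" where
  "w_min V E w = (INF (x, y)\<in>(SIGMA x:V. nbrs E x). ereal (w x y))"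

text \<open>
  \<open>((\<lambda>a b. b \<in> nbrs E a) ^^ n) x y\<close> says that there is a walk with \<open>n\<close> edges from \<open>x\<close> to \<open>y\<close>. A
  shortest walk is a path, and the infimum of the empty set in \<^typ>\<open>enat\<close> is \<open>\<infinity>\<close>.
\<close>

definition gdist :: "'a set set \<Rightarrow> 'a \<Rightarrow> 'a \<Rightarrow> enat" where
  "gdist E x y = Inf {enat n | n. ((\<lambda>a b. b \<in> nbrs E a) ^^ n) x y}"

definition gball :: "'a set \<Rightarrow> 'a set set \<Rightarrow> 'a \<Rightarrow> real \<Rightarrow> 'a set" where
  "gball V E x r = {z \<in> V. ereal_of_enat (gdist E x z) < ereal r}"

text \<open>Balls of a locally finite graph are finite, so a finite sum suffices for their volume.\<close>

definition vol :: "('a \<Rightarrow> real) \<Rightarrow> 'a set \<Rightarrow> real" where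
  "vol \<mu> A = (\<Sum>z\<in>A. \<mu> z)"

definition bounded_heat_solution ::
  "'a set \<Rightarrow> 'a set set \<Rightarrow> ('a \<Rightarrow> 'a \<Rightarrow> real) \<Rightarrow> ('a \<Rightarrow> real) \<Rightarrow>
    ('a \<Rightarrow> real) \<Rightarrow> ('a \<Rightarrow> real \<Rightarrow> real) \<Rightarrow> bool" where
  "bounded_heat_solution V E w \<mu> u0 u \<longleftrightarrow>
    (\<exists>C. \<forall>x\<in>V. \<forall>t>0. \<bar>u x t\<bar> \<le> C) \<and>
    (\<forall>x\<in>V. \<forall>t>0. (u x has_real_derivative laplacian E w \<mu> (\<lambda>z. u z t) x) (at t)) \<and>
    (\<forall>x\<in>V. (u x \<longlongrightarrow> u0 x) (at_right 0))"

text \<open>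
  Summability is required separately because \<^const>\<open>infsum\<close> is \<open>0\<close> on functions that are not
  summable.
\<close>

definition is_heat_kernel ::
  "'a set \<Rightarrow> 'a set set \<Rightarrow> ('a \<Rightarrow> 'a \<Rightarrow> real) \<Rightarrow> ('a \<Rightarrow> real) \<Rightarrow>
    (real \<Rightarrow> 'a \<Rightarrow> 'a \<Rightarrow> real) \<Rightarrow> bool" where
  "is_heat_kernel V E w \<mu> p \<longleftrightarrow>
    (\<forall>u0. bounded (u0 ` V) \<longrightarrow>
      (\<forall>x\<in>V. \<forall>t>0. (\<lambda>y. \<mu> y * p t x y * u0 y) summable_on V) \<and>
      bounded_heat_solution V E w \<mu> u0 (\<lambda>x t. \<Sum>\<^sub>\<infinity>y\<in>V. \<mu> y * p t x y * u0 y))"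

end

theory Submission
  imports Defs
begin

text \<open>
  Since \<open>deg(x) \<le> D \<mu>(x)\<close>, the operator \<open>A = \<Delta> + D\<close> has nonnegative coefficients and norm at most \<open>D\<close> on
  bounded functions. If \<open>u\<close> is a bounded solution of the heat equation, then \<open>v = e\<^sup>D\<^sup>t u\<close> solves
  \<open>\<partial>\<^sub>t v = A v\<close>, and integrating the remainder of the exponential series over and over gives
  \<open>e\<^sup>D\<^sup>t u(t) = \<Sum> t\<^sup>k/k! A\<^sup>k u\<^sub>0\<close> (\<open>heat_solution_sums\<close>). For \<open>u\<^sub>0 \<ge> 0\<close> all terms of this series are nonnegative, so
  every property of \<open>u\<close> can be read off from the powers of \<open>A\<close>:

  \<^item> \<open>u \<ge> 0\<close>;
  \<^item> the total mass \<open>\<Sum> \<mu>(x) u(x,t)\<close> does not exceed the initial one, because for symmetric weights \<open>A\<close>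
    has norm at most \<open>D\<close> also with respect to \<open>\<mu>\<close>-integration (\<open>heat_solution_mass_le\<close>);
  \<^item> if \<open>c \<mu>(a) \<le> w\<^sub>a\<^sub>b\<close> on all edges, each step of a walk costs at most a factor \<open>c\<close>, so the term with index
    \<open>d = dist(x,y)\<close> alone gives \<open>e\<^sup>D\<^sup>s u(x,t+s) \<ge> (cs)\<^sup>d/d! u(y,t)\<close> (\<open>heat_solution_walk_bound\<close>).

  The last item is a Harnack inequality; together with the elementary \<open>d!/a\<^sup>d \<le> exp(d\<^sup>2/a)\<close> it reads
  \<open>u(y,t) \<le> u(x,t+s) exp(Ds + d\<^sup>2/(cs))\<close>. Both parts follow from it with \<open>u = p(\<sqdot>,\<sqdot>,y)\<close> and
  \<open>c = w_min/\<mu>_max\<close>. For (i), compare \<open>p(t,x,y)\<close> with \<open>p(t+s,z,y)\<close> for all \<open>z\<close> in the ball of radius \<open>\<surd>t\<close>,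
  average over the ball, and use that the mass at time \<open>t+s\<close> is at most \<open>1\<close>; the choice
  \<open>s = \<surd>(t/(cD))\<close>, which balances \<open>Ds\<close> against \<open>t/(cs)\<close>, gives the exponent \<open>2\<surd>(Dt/c) \<le> 4\<surd>(2Dt/c)\<close>. For (ii), start the
  comparison at time \<open>0\<close>, where the kernel is \<open>1/\<mu>(y)\<close> at \<open>y\<close>; here \<open>D = 1\<close>.
\<close>

section \<open>Calculus preliminaries\<close>

lemma le_of_derivative_le_at_right:
  fixes g h :: "real \<Rightarrow> real"
  assumes g: "\<And>s. s > 0 \<Longrightarrow> (g has_real_derivative g' s) (at s)"
    and h: "\<And>s. s > 0 \<Longrightarrow> (h has_real_derivative h' s) (at s)"
    and le: "\<And>s. s > 0 \<Longrightarrow> g' s \<le> h' s"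
    and g0: "(g \<longlongrightarrow> l) (at_right 0)" and h0: "(h \<longlongrightarrow> l) (at_right 0)"
    and t: "t > 0"
  shows "g t \<le> h t"
proof -
  have mono: "h s - g s \<le> h t - g t" if "0 < s" "s < t" for s
  proof (rule DERIV_nonneg_imp_nondecreasing[of s t "\<lambda>r. h r - g r"])
    show "\<exists>y. ((\<lambda>r. h r - g r) has_real_derivative y) (at r) \<and> 0 \<le> y" if "s \<le> r" "r \<le> t" for r
      using g[of r] h[of r] le[of r] that \<open>0 < s\<close>
      by (intro exI[of _ "h' r - g' r"]) (auto intro!: derivative_eq_intros)
  qed (use that in auto)
  have "l - l \<le> h t - g t"
  proof (rule tendsto_upperbound)
    show "((\<lambda>s. h s - g s) \<longlongrightarrow> l - l) (at_right 0)"
      by (intro tendsto_diff g0 h0)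
    show "\<forall>\<^sub>F s in at_right 0. h s - g s \<le> h t - g t"
      using t mono by (auto simp: eventually_at_right_field)
  qed auto
  then show ?thesis by simp
qed

lemma DERIV_power_over_fact:
  "((\<lambda>r. (D * r) ^ Suc n / fact (Suc n)) has_real_derivative D * ((D * s) ^ n / fact n)) (at s)"
  for D s :: real
proof -
  have "((\<lambda>r. (D * r) ^ Suc n) has_real_derivative (1 + real n) * (D * (D * s) ^ n)) (at s)"
    by (rule DERIV_power_Suc) (rule DERIV_cmult_Id)
  then have "((\<lambda>r. (D * r) ^ Suc n / fact (Suc n)) has_real_derivative
      (1 + real n) * (D * (D * s) ^ n) / fact (Suc n)) (at s)"
    by (rule DERIV_cdivide)
  moreover have "(1 + real n) * (D * (D * s) ^ n) / fact (Suc n) = D * ((D * s) ^ n / fact n)"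
    by (simp add: divide_simps del: of_nat_Suc)
  ultimately show ?thesis
    by metis
qed

text \<open>From \<open>d! \<le> d\<^sup>d\<close> and \<open>d/a \<le> exp(d/a)\<close>; for \<open>d = 0\<close> both sides are \<open>1\<close>.\<close>

lemma exp_minus_square_le_power_over_fact:
  fixes a :: real
  assumes "a > 0"
  shows "exp (- ((real d)\<^sup>2 / a)) \<le> a ^ d / fact d"
proof -
  have "fact d / a ^ d \<le> real d ^ d / a ^ d"
    using fact_le_power[of d, where ?'a = real] assms by (intro divide_right_mono) auto
  also have "\<dots> = (real d / a) ^ d"
    by (simp add: power_divide)
  also have "\<dots> \<le> exp (real d / a) ^ d"
    using assms exp_ge_add_one_self[of "real d / a"] by (intro power_mono) (simp_all del: exp_ge_add_one_self)
  also have "\<dots> = exp ((real d)\<^sup>2 / a)"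
    by (simp add: exp_of_nat_mult[symmetric] power2_eq_square)
  finally have "fact d \<le> exp ((real d)\<^sup>2 / a) * a ^ d"
    using assms by (simp add: divide_simps)
  then show ?thesis
    by (simp add: exp_minus divide_simps mult.commute)
qed

section \<open>Walks and balls\<close>

lemma nbrs_sym: "y \<in> nbrs E x \<longleftrightarrow> x \<in> nbrs E y"
  by (simp add: nbrs_def insert_commute)

lemma walk_sym:
  "((\<lambda>a b. b \<in> nbrs E a) ^^ n) x y \<Longrightarrow> ((\<lambda>a b. b \<in> nbrs E a) ^^ n) y x"
proof (induction n arbitrary: y)
  case (Suc n)
  then obtain z where "((\<lambda>a b. b \<in> nbrs E a) ^^ n) z x" "y \<in> nbrs E z"
    by auto
  then show ?case
    by (intro relpowp_Suc_I2[where y = z]) (simp_all add: nbrs_sym)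
qed auto

lemma gdist_enat_imp_walk:
  assumes "gdist E x y = enat d"
  shows "((\<lambda>a b. b \<in> nbrs E a) ^^ d) x y"
proof -
  let ?S = "{enat n |n. ((\<lambda>a b. b \<in> nbrs E a) ^^ n) x y}"
  have "?S \<noteq> {}"
    using assms by (auto simp: gdist_def Inf_enat_def split: if_splits)
  then have "Inf ?S \<in> ?S"
    unfolding Inf_enat_def by (auto intro: LeastI)
  then show ?thesis
    using assms by (auto simp: gdist_def)
qed

lemma gballE:
  assumes "z \<in> gball V E x r"
  obtains d where "gdist E x z = enat d" "real d < r" "z \<in> V"
  using assms by (cases "gdist E x z") (auto simp: gball_def)

lemma (in weighted_graph) nbrs_subset: "nbrs E x \<subseteq> V"
  using edges by (fastforce simp: nbrs_def doubleton_eq_iff)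

lemma (in weighted_graph) finite_gball:
  assumes x: "x \<in> V"
  shows "finite (gball V E x r)"
proof -
  let ?R = "\<lambda>a b. b \<in> nbrs E a"
  have *: "finite {z. (?R ^^ n) x z} \<and> {z. (?R ^^ n) x z} \<subseteq> V" for n
  proof (induction n)
    case (Suc n)
    have "{z. (?R ^^ Suc n) x z} = (\<Union>y\<in>{z. (?R ^^ n) x z}. nbrs E y)"
      by auto
    then show ?case
      using Suc locally_finite nbrs_subset by auto
  qed (use x in auto)
  have "gball V E x r \<subseteq> (\<Union>n\<in>{..nat \<lceil>r\<rceil>}. {z. (?R ^^ n) x z})"
  proof
    fix z assume "z \<in> gball V E x r"
    then obtain d where "gdist E x z = enat d" "real d < r"
      by (rule gballE)
    then show "z \<in> (\<Union>n\<in>{..nat \<lceil>r\<rceil>}. {z. (?R ^^ n) x z})"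
      using gdist_enat_imp_walk by (intro UN_I[of d]) (auto, linarith)
  qed
  then show ?thesis
    using * by (auto intro: finite_subset)
qed

lemma self_in_gball: "x \<in> V \<Longrightarrow> r > 0 \<Longrightarrow> x \<in> gball V E x r"
proof -
  assume "x \<in> V" "r > 0"
  moreover have "gdist E x x \<le> enat 0"
    unfolding gdist_def by (intro Inf_lower) (auto intro!: exI[of _ 0])
  ultimately show ?thesis
    by (simp add: gball_def flip: zero_enat_def)
qed

section \<open>The positive operator behind the heat semigroup\<close>

locale bounded_degree_graph = weighted_graph +
  fixes D :: real
  assumes D_nonneg: "D \<ge> 0"
    and wdeg_le: "x \<in> V \<Longrightarrow> wdeg E w x \<le> D * \<mu> x"
begin

lemma edgeD:
  assumes "y \<in> nbrs E x"
  shows "y \<in> V" "w x y > 0"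
  using assms nbrs_subset weight_pos by (auto simp: nbrs_def)

lemma wdeg_nonneg: "wdeg E w x \<ge> 0"
  unfolding wdeg_def by (intro sum_nonneg) (simp add: edgeD less_imp_le)

text \<open>
  Adding \<open>D\<close> makes the diagonal coefficient \<open>D - deg(x)/\<mu>(x)\<close> nonnegative; the price is the factor
  \<open>e\<^sup>D\<^sup>t\<close> between the solutions of \<open>\<partial>\<^sub>t u = \<Delta> u\<close> and of \<open>\<partial>\<^sub>t v = A v\<close>.
\<close>

definition A :: "('a \<Rightarrow> real) \<Rightarrow> 'a \<Rightarrow> real" where
  "A f x = laplacian E w \<mu> f x + D * f x"

lemma measure_A:
  assumes "x \<in> V"
  shows "\<mu> x * A f x = (\<Sum>y\<in>nbrs E x. w x y * f y) + (D * \<mu> x - wdeg E w x) * f x"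
  using measure_pos[OF assms]
  by (simp add: A_def laplacian_def wdeg_def algebra_simps sum_subtractf sum_distrib_left)

lemma
  shows A_scale: "A (\<lambda>z. c * f z) x = c * A f x"
    and A_diff: "A (\<lambda>z. f z - g z) x = A f x - A g x"
    and A_sum: "A (\<lambda>z. \<Sum>k<(n::nat). F k z) x = (\<Sum>k<n. A (F k) x)"
proof -
  show "A (\<lambda>z. c * f z) x = c * A f x"
    by (simp add: A_def laplacian_def algebra_simps sum_subtractf sum_distrib_left)
  show "A (\<lambda>z. f z - g z) x = A f x - A g x"
    by (simp add: A_def laplacian_def algebra_simps sum_subtractf sum.distrib)
  have add: "A (\<lambda>z. f z + g z) x = A f x + A g x" for f g
    by (simp add: A_def laplacian_def algebra_simps sum_subtractf sum.distrib)
  have zero: "A (\<lambda>z. 0) x = 0"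
    by (simp add: A_def laplacian_def)
  show "A (\<lambda>z. \<Sum>k<n. F k z) x = (\<Sum>k<n. A (F k) x)"
    by (induction n) (simp_all add: zero add)
qed

lemma A_abs_le:
  assumes x: "x \<in> V" and f: "\<And>z. z \<in> V \<Longrightarrow> \<bar>f z\<bar> \<le> B"
  shows "\<bar>A f x\<bar> \<le> D * B"
proof -
  have "\<mu> x * \<bar>A f x\<bar> = \<bar>\<mu> x * A f x\<bar>"
    using measure_pos[OF x] by (simp add: abs_mult)
  also have "\<dots> \<le> \<bar>\<Sum>y\<in>nbrs E x. w x y * f y\<bar> + \<bar>(D * \<mu> x - wdeg E w x) * f x\<bar>"
    unfolding measure_A[OF x] by (rule abs_triangle_ineq)
  also have "\<dots> \<le> (\<Sum>y\<in>nbrs E x. w x y * B) + (D * \<mu> x - wdeg E w x) * B"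
  proof (intro add_mono order.trans[OF sum_abs] sum_mono)
    fix y assume y: "y \<in> nbrs E x"
    then show "\<bar>w x y * f y\<bar> \<le> w x y * B"
      using f[of y] edgeD[OF y] by (simp add: abs_mult)
  next
    show "\<bar>(D * \<mu> x - wdeg E w x) * f x\<bar> \<le> (D * \<mu> x - wdeg E w x) * B"
      using wdeg_le[OF x] f[OF x] by (simp add: abs_mult mult_left_mono)
  qed
  also have "\<dots> = \<mu> x * (D * B)"
    unfolding wdeg_def sum_distrib_right[symmetric] by (simp add: algebra_simps)
  finally show ?thesis
    using measure_pos[OF x] by simp
qed

lemma A_ge_nbr:
  assumes x: "x \<in> V" and y: "y \<in> nbrs E x" and f: "\<And>z. z \<in> V \<Longrightarrow> f z \<ge> 0"
  shows "\<mu> x * A f x \<ge> w x y * f y"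
proof -
  have "w x y * f y \<le> (\<Sum>y\<in>nbrs E x. w x y * f y)"
    using y locally_finite[OF x] f
    by (intro member_le_sum) (auto simp: edgeD less_imp_le)
  moreover have "(D * \<mu> x - wdeg E w x) * f x \<ge> 0"
    using wdeg_le[OF x] f[OF x] by simp
  ultimately show ?thesis
    unfolding measure_A[OF x] by linarith
qed

lemma A_nonneg:
  assumes x: "x \<in> V" and f: "\<And>z. z \<in> V \<Longrightarrow> f z \<ge> 0"
  shows "A f x \<ge> 0"
proof -
  have "(\<Sum>y\<in>nbrs E x. w x y * f y) \<ge> 0"
    using f by (intro sum_nonneg) (simp add: edgeD less_imp_le)
  moreover have "(D * \<mu> x - wdeg E w x) * f x \<ge> 0"
    using wdeg_le[OF x] f[OF x] by simp
  ultimately have "\<mu> x * A f x \<ge> 0"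
    unfolding measure_A[OF x] by linarith
  then show ?thesis
    using measure_pos[OF x] by (simp add: zero_le_mult_iff)
qed

lemma A_pow_nonneg:
  assumes "\<And>z. z \<in> V \<Longrightarrow> f z \<ge> 0" "x \<in> V"
  shows "(A ^^ n) f x \<ge> 0"
  using assms by (induction n arbitrary: x) (auto intro: A_nonneg)

text \<open>
  Positivity allows all terms of \<open>A\<close> but the one for the next edge of the walk to be discarded, and that
  one has coefficient at least \<open>c\<close>.
\<close>

lemma A_pow_walk:
  assumes c: "c \<ge> 0" "\<And>a b. a \<in> V \<Longrightarrow> b \<in> nbrs E a \<Longrightarrow> c * \<mu> a \<le> w a b"
    and f: "\<And>z. z \<in> V \<Longrightarrow> f z \<ge> 0"
    and "x \<in> V" "((\<lambda>a b. b \<in> nbrs E a) ^^ n) x y"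
  shows "(A ^^ n) f x \<ge> c ^ n * f y"
  using assms(4-)
proof (induction n arbitrary: x)
  case (Suc n)
  from Suc.prems(2) obtain z where z: "z \<in> nbrs E x" "((\<lambda>a b. b \<in> nbrs E a) ^^ n) z y"
    by (blast elim: relpowp_Suc_E2)
  then have zV: "z \<in> V" 
    using nbrs_subset by blast
  have "\<mu> x * (c ^ Suc n * f y) = c * \<mu> x * (c ^ n * f y)"
    by simp
  also have "\<dots> \<le> c * \<mu> x * (A ^^ n) f z"
    using Suc.IH[OF zV z(2)] c(1) measure_pos[OF Suc.prems(1)] by (intro mult_left_mono) auto
  also have "\<dots> \<le> w x z * (A ^^ n) f z"
    using c(2)[OF Suc.prems(1) z(1)] A_pow_nonneg[OF f zV] by (intro mult_right_mono) auto
  also have "\<dots> \<le> \<mu> x * A ((A ^^ n) f) x"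
    using A_pow_nonneg[OF f] by (intro A_ge_nbr Suc.prems z) auto
  finally show ?case
    using measure_pos[OF Suc.prems(1)] by simp
qed simp

text \<open>
  Summing \<open>\<mu> A f\<close> over \<open>F\<close> and exchanging the sums, symmetry turns the total weight arriving from \<open>y\<close>
  into at most \<open>deg(y)\<close>, which cancels against the diagonal part \<open>D \<mu>(y) - deg(y)\<close>. The finite sets in
  the hypothesis have to be arbitrary since the mass in \<open>F\<close> comes from \<open>F\<close> and its neighbours.
\<close>

lemma A_mass_le:
  assumes sym: "\<And>a b. {a, b} \<in> E \<Longrightarrow> w a b = w b a"
    and f: "\<And>z. z \<in> V \<Longrightarrow> f z \<ge> 0"
    and M: "\<And>F. finite F \<Longrightarrow> F \<subseteq> V \<Longrightarrow> (\<Sum>x\<in>F. \<mu> x * f x) \<le> M"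
    and F: "finite F" "F \<subseteq> V"
  shows "(\<Sum>x\<in>F. \<mu> x * A f x) \<le> D * M"
proof -
  define G where "G = F \<union> (\<Union>x\<in>F. nbrs E x)"
  have G: "finite G" "G \<subseteq> V" "F \<subseteq> G"
    using F locally_finite nbrs_subset by (auto simp: G_def)
  have "(\<Sum>x\<in>F. \<Sum>y\<in>nbrs E x. w x y * f y) = (\<Sum>x\<in>F. \<Sum>y | y \<in> G \<and> y \<in> nbrs E x. w x y * f y)"
    by (intro sum.cong refl) (auto simp: G_def)
  also have "\<dots> = (\<Sum>y\<in>G. \<Sum>x | x \<in> F \<and> y \<in> nbrs E x. w x y * f y)"
    using F G by (intro sum.swap_restrict)
  also have "\<dots> \<le> (\<Sum>y\<in>G. wdeg E w y * f y)"
  proof (rule sum_mono)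
    fix y assume y: "y \<in> G"
    then have "y \<in> V" using G by auto
    have "(\<Sum>x | x \<in> F \<and> y \<in> nbrs E x. w x y * f y) = (\<Sum>x | x \<in> F \<and> y \<in> nbrs E x. w y x * f y)"
      using sym by (intro sum.cong refl) (auto simp: nbrs_def)
    also have "\<dots> \<le> (\<Sum>x\<in>nbrs E y. w y x * f y)"
      using locally_finite f \<open>y \<in> V\<close>
      by (intro sum_mono2) (auto simp: edgeD(2) less_imp_le, simp add: nbrs_def insert_commute)
    finally show "(\<Sum>x | x \<in> F \<and> y \<in> nbrs E x. w x y * f y) \<le> wdeg E w y * f y"
      by (simp add: wdeg_def sum_distrib_right)
  qed
  finally have off: "(\<Sum>x\<in>F. \<Sum>y\<in>nbrs E x. w x y * f y) \<le> (\<Sum>y\<in>G. wdeg E w y * f y)" .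
  have diag: "(\<Sum>x\<in>F. (D * \<mu> x - wdeg E w x) * f x) \<le> (\<Sum>x\<in>G. (D * \<mu> x - wdeg E w x) * f x)"
    using G wdeg_le f by (intro sum_mono2) (auto intro!: mult_nonneg_nonneg)
  have "(\<Sum>x\<in>F. \<mu> x * A f x)
      = (\<Sum>x\<in>F. \<Sum>y\<in>nbrs E x. w x y * f y) + (\<Sum>x\<in>F. (D * \<mu> x - wdeg E w x) * f x)"
    using F by (simp add: measure_A subset_iff flip: sum.distrib)
  also have "\<dots> \<le> (\<Sum>y\<in>G. wdeg E w y * f y) + (\<Sum>x\<in>G. (D * \<mu> x - wdeg E w x) * f x)"
    by (intro add_mono off diag)
  also have "\<dots> = D * (\<Sum>x\<in>G. \<mu> x * f x)"
    by (simp add: sum_distrib_left algebra_simps flip: sum.distrib)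
  also have "\<dots> \<le> D * M"
    using M[OF G(1,2)] D_nonneg by (rule mult_left_mono)
  finally show ?thesis .
qed

section \<open>Bounded solutions as exponential series\<close>

text \<open>
  The remainders \<open>r\<^sub>n\<close> of the series satisfy \<open>\<partial>\<^sub>t r\<^sub>n\<^sub>+\<^sub>1 = A r\<^sub>n\<close>, and \<open>r\<^sub>n\<^sub>+\<^sub>1\<close> vanishes at time \<open>0\<close>, so a bound on
  \<open>r\<^sub>n\<close> integrates to one on \<open>r\<^sub>n\<^sub>+\<^sub>1\<close>. Convergence to the initial values is only pointwise, but this is enough:
  the comparison is made at one vertex at a time, and uniformity in the vertex comes from the norm of
  \<open>A\<close>. Keeping the factor \<open>e\<^sup>D\<^sup>t\<close> in the bound makes it valid for all times at once.
\<close>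

lemma heat_solution_remainder:
  assumes u: "\<And>x t. x \<in> V \<Longrightarrow> t > 0 \<Longrightarrow>
      (u x has_real_derivative laplacian E w \<mu> (\<lambda>z. u z t) x) (at t)"
    and u0: "\<And>x. x \<in> V \<Longrightarrow> (u x \<longlongrightarrow> u0 x) (at_right 0)"
    and bound: "\<And>x t. x \<in> V \<Longrightarrow> t > 0 \<Longrightarrow> \<bar>u x t\<bar> \<le> C"
    and "x \<in> V" "t > 0"
  shows "\<bar>exp (D * t) * u x t - (\<Sum>k<n. t ^ k / fact k * (A ^^ k) u0 x)\<bar>
    \<le> C * exp (D * t) * ((D * t) ^ n / fact n)"
  using assms(4,5)
proof (induction n arbitrary: x t)
  case 0
  then show ?case
    using bound[of x t] by (simp add: abs_mult mult.commute)
next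
  case (Suc n)
  define P where "P n x s = (\<Sum>k<n. s ^ k / fact k * (A ^^ k) u0 x)" for n x s
  define g where "g = (\<lambda>s. exp (D * s) * u x s - P (Suc n) x s)"
  define g' where "g' s = A (\<lambda>z. exp (D * s) * u z s - P n z s) x" for s
  define h where "h = (\<lambda>s. C * exp (D * s) * ((D * s) ^ Suc n / fact (Suc n)))"
  define h' where "h' s = D * h s + D * (C * exp (D * s) * ((D * s) ^ n / fact n))" for s
  have x: "x \<in> V" by fact
  have D: "D \<ge> 0" by (rule D_nonneg)
  have C: "C \<ge> 0" using bound[OF x, of 1] by linarith
  \<comment> \<open>Differentiation shifts the partial sums of the series down by one.\<close>
  have P': "(P (Suc m) x has_real_derivative A (\<lambda>z. P m z s) x) (at s)" for m s
  proof (induction m)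
    case 0
    have "A (\<lambda>z. 0) x = 0" using A_sum[of "\<lambda>_ _. 0" 0] by simp
    then show ?case by (simp add: P_def)
  next
    case (Suc m)
    have "((\<lambda>r. r ^ Suc m / fact (Suc m)) has_real_derivative s ^ m / fact m) (at s)"
      using DERIV_power_over_fact[of 1 m s] by simp
    then have "((\<lambda>r. P (Suc m) x r + r ^ Suc m / fact (Suc m) * (A ^^ Suc m) u0 x)
        has_real_derivative A (\<lambda>z. P m z s) x + s ^ m / fact m * (A ^^ Suc m) u0 x) (at s)"
      by (intro DERIV_add Suc DERIV_cmult_right)
    moreover have "(\<lambda>r. P (Suc m) x r + r ^ Suc m / fact (Suc m) * (A ^^ Suc m) u0 x) = P (Suc (Suc m)) x"
      by (simp add: P_def fun_eq_iff)
    moreover have "A (\<lambda>z. P (Suc m) z s) x = A (\<lambda>z. P m z s) x + s ^ m / fact m * (A ^^ Suc m) u0 x"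
      unfolding P_def A_sum A_scale by simp
    ultimately show ?case
      by (simp only:)
  qed
  have gd: "(g has_real_derivative g' s) (at s)" if "s > 0" for s
  proof -
    have "((\<lambda>r. exp (D * r) * u x r) has_real_derivative
        exp (D * s) * D * u x s + laplacian E w \<mu> (\<lambda>z. u z s) x * exp (D * s)) (at s)"
      by (rule DERIV_mult[OF DERIV_fun_exp[OF DERIV_cmult_Id] u[OF x that]])
    then have "((\<lambda>r. exp (D * r) * u x r) has_real_derivative A (\<lambda>z. exp (D * s) * u z s) x) (at s)"
      unfolding A_scale A_def by (simp add: algebra_simps)
    then show ?thesis
      unfolding g_def g'_def A_diff by (rule DERIV_diff[OF _ P'])
  qed
  have hd: "(h has_real_derivative h' s) (at s)" for s
  proof -
    have "(h has_real_derivative C * (exp (D * s) * D) * ((D * s) ^ Suc n / fact (Suc n))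
        + D * ((D * s) ^ n / fact n) * (C * exp (D * s))) (at s)"
      unfolding h_def
      by (rule DERIV_mult[OF DERIV_cmult[OF DERIV_fun_exp[OF DERIV_cmult_Id]] DERIV_power_over_fact])
    then show ?thesis
      by (simp add: h_def h'_def mult_ac del: power_Suc fact_Suc)
  qed
  have le: "\<bar>g' s\<bar> \<le> h' s" if "s > 0" for s
  proof -
    have "\<bar>g' s\<bar> \<le> D * (C * exp (D * s) * ((D * s) ^ n / fact n))"
      unfolding g'_def using Suc.IH that by (intro A_abs_le x) (simp add: P_def)
    moreover have "D * h s \<ge> 0"
      using D C that by (auto simp: h_def intro!: mult_nonneg_nonneg divide_nonneg_nonneg)
    ultimately show ?thesis
      by (simp add: h'_def)
  qed
  have g0: "(g \<longlongrightarrow> 0) (at_right 0)"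
  proof -
    have "(P (Suc n) x \<longlongrightarrow> P (Suc n) x 0) (at_right 0)"
      using DERIV_isCont[OF P'] by (simp add: isCont_def filterlim_at_split)
    moreover have "P (Suc n) x 0 = u0 x"
      by (simp add: P_def lessThan_Suc_eq_insert_0 sum.reindex)
    moreover have "((\<lambda>s. exp (D * s)) \<longlongrightarrow> exp (D * 0)) (at_right 0)"
      by (intro tendsto_intros)
    ultimately have "(g \<longlongrightarrow> exp (D * 0) * u0 x - u0 x) (at_right 0)"
      unfolding g_def by (intro tendsto_diff tendsto_mult u0[OF x]) auto
    then show ?thesis by simp
  qed
  have h0: "(h \<longlongrightarrow> 0) (at_right 0)"
    using DERIV_isCont[OF hd, of 0] by (simp add: isCont_def filterlim_at_split h_def)
  have "g t \<le> h t"
    by (rule le_of_derivative_le_at_right[OF gd hd _ g0 h0]) (use le \<open>t > 0\<close> in \<open>auto simp: abs_le_iff\<close>)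
  moreover have "- g t \<le> h t"
    by (rule le_of_derivative_le_at_right[OF DERIV_minus[OF gd] hd _ _ h0])
      (use le \<open>t > 0\<close> tendsto_minus[OF g0] in \<open>auto simp: abs_le_iff\<close>)
  ultimately show ?case
    by (simp add: g_def h_def P_def abs_le_iff)
qed

text \<open>
  In particular a bounded solution is determined by its initial values, and an abstractly given heat
  kernel can be computed from \<open>A\<close>.
\<close>

lemma heat_solution_sums:
  assumes u: "bounded_heat_solution V E w \<mu> u0 u" and x: "x \<in> V" and t: "t > 0"
  shows "(\<lambda>k. t ^ k / fact k * (A ^^ k) u0 x) sums (exp (D * t) * u x t)"
proof -
  obtain C where C: "\<And>x t. x \<in> V \<Longrightarrow> t > 0 \<Longrightarrow> \<bar>u x t\<bar> \<le> C"
    using u by (auto simp: bounded_heat_solution_def)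
  have "(\<lambda>n. (D * t) ^ n / fact n) \<longlonglongrightarrow> 0"
    using summable_LIMSEQ_zero[OF summable_exp[of "D * t"]] by (simp add: field_simps)
  then have lim: "(\<lambda>n. C * exp (D * t) * ((D * t) ^ n / fact n)) \<longlonglongrightarrow> 0"
    by (rule tendsto_mult_right_zero)
  have bound: "norm ((\<Sum>k<n. t ^ k / fact k * (A ^^ k) u0 x) - exp (D * t) * u x t)
      \<le> C * exp (D * t) * ((D * t) ^ n / fact n)" for n
    unfolding real_norm_def
    using heat_solution_remainder[of u u0 C x t n] u C x t
    by (subst abs_minus_commute) (auto simp: bounded_heat_solution_def)
  have "(\<lambda>n. (\<Sum>k<n. t ^ k / fact k * (A ^^ k) u0 x) - exp (D * t) * u x t) \<longlonglongrightarrow> 0"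
    by (rule Lim_null_comparison[OF always_eventually lim]) (intro allI bound)
  then show ?thesis
    unfolding sums_def by (rule LIM_zero_cancel)
qed

section \<open>Positivity, Harnack inequality and mass\<close>

lemma heat_solution_nonneg:
  assumes "bounded_heat_solution V E w \<mu> u0 u" "\<And>z. z \<in> V \<Longrightarrow> u0 z \<ge> 0" "x \<in> V" "t > 0"
  shows "u x t \<ge> 0"
proof -
  have "0 \<le> exp (D * t) * u x t"
    using A_pow_nonneg[OF assms(2) assms(3)] assms(4)
    by (intro sums_le[OF _ sums_zero heat_solution_sums[OF assms(1,3,4)]]) auto
  then show ?thesis
    by (simp add: zero_le_mult_iff)
qed

text \<open>The \<open>d\<close>-th term of the series is at most the whole sum.\<close>

lemma heat_solution_walk_bound:
  assumes u: "bounded_heat_solution V E w \<mu> u0 u" and u0: "\<And>z. z \<in> V \<Longrightarrow> u0 z \<ge> 0"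
    and c: "c \<ge> 0" "\<And>a b. a \<in> V \<Longrightarrow> b \<in> nbrs E a \<Longrightarrow> c * \<mu> a \<le> w a b"
    and x: "x \<in> V" and walk: "((\<lambda>a b. b \<in> nbrs E a) ^^ d) x y" and t: "t > 0"
  shows "(c * t) ^ d / fact d * u0 y \<le> exp (D * t) * u x t"
proof -
  have "c ^ d * u0 y \<le> (A ^^ d) u0 x"
    by (rule A_pow_walk[OF c u0 x walk])
  then have "t ^ d / fact d * (c ^ d * u0 y) \<le> t ^ d / fact d * (A ^^ d) u0 x"
    using t by (intro mult_left_mono) auto
  then have "(c * t) ^ d / fact d * u0 y \<le> t ^ d / fact d * (A ^^ d) u0 x"
    by (simp add: power_mult_distrib mult_ac)
  also have "\<dots> \<le> exp (D * t) * u x t"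
  proof -
    note s = heat_solution_sums[OF u x t]
    have "(\<Sum>k\<in>{d}. t ^ k / fact k * (A ^^ k) u0 x) \<le> (\<Sum>k. t ^ k / fact k * (A ^^ k) u0 x)"
      using s A_pow_nonneg[OF u0 x] t by (intro sum_le_suminf) (auto simp: sums_iff)
    then show ?thesis
      using s by (simp add: sums_iff)
  qed
  finally show ?thesis .
qed

text \<open>By this the previous lemma also compares two positive times.\<close>

lemma heat_solution_shift:
  assumes u: "bounded_heat_solution V E w \<mu> u0 u" and t: "t > 0"
  shows "bounded_heat_solution V E w \<mu> (\<lambda>x. u x t) (\<lambda>x s. u x (t + s))"
  unfolding bounded_heat_solution_def
proof (intro conjI ballI allI impI)
  show "\<exists>C. \<forall>x\<in>V. \<forall>s>0. \<bar>u x (t + s)\<bar> \<le> C"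
    using u t unfolding bounded_heat_solution_def by (meson add_pos_pos)
next
  fix x and s :: real assume x: "x \<in> V" and "s > 0"
  then show "((\<lambda>s. u x (t + s)) has_real_derivative laplacian E w \<mu> (\<lambda>z. u z (t + s)) x) (at s)"
    using u t by (simp add: bounded_heat_solution_def DERIV_shift[symmetric] add.commute)
next
  fix x assume "x \<in> V"
  then have "isCont (u x) t"
    using u t unfolding bounded_heat_solution_def by (metis DERIV_isCont)
  then have "((\<lambda>s. u x (t + s)) \<longlongrightarrow> u x t) (at 0)"
    by (simp add: isCont_iff)
  then show "((\<lambda>s. u x (t + s)) \<longlongrightarrow> u x t) (at_right 0)"
    by (simp add: filterlim_at_split)
qed

lemma heat_solution_mass_le:
  assumes u: "bounded_heat_solution V E w \<mu> u0 u" and u0: "\<And>z. z \<in> V \<Longrightarrow> u0 z \<ge> 0"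
    and sym: "\<And>a b. {a, b} \<in> E \<Longrightarrow> w a b = w b a"
    and M: "\<And>F. finite F \<Longrightarrow> F \<subseteq> V \<Longrightarrow> (\<Sum>x\<in>F. \<mu> x * u0 x) \<le> M"
    and F: "finite F" "F \<subseteq> V" and t: "t > 0"
  shows "(\<Sum>x\<in>F. \<mu> x * u x t) \<le> M"
proof -
  have mass: "(\<Sum>x\<in>F. \<mu> x * (A ^^ k) u0 x) \<le> D ^ k * M" if "finite F" "F \<subseteq> V" for k F
    using that
  proof (induction k arbitrary: F)
    case (Suc k)
    then show ?case
      using A_mass_le[OF sym A_pow_nonneg[OF u0] Suc.IH] by (simp add: mult.assoc)
  qed (use M in auto)
  have "(\<lambda>k. \<Sum>x\<in>F. \<mu> x * (t ^ k / fact k * (A ^^ k) u0 x)) sums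
      (\<Sum>x\<in>F. \<mu> x * (exp (D * t) * u x t))"
    using F by (intro sums_sum sums_mult heat_solution_sums[OF u _ t]) auto
  moreover have "(\<lambda>k. (D * t) ^ k / fact k * M) sums (exp (D * t) * M)"
    using exp_converges[of "D * t"] by (intro sums_mult2) (simp add: field_simps)
  moreover have "(\<Sum>x\<in>F. \<mu> x * (t ^ k / fact k * (A ^^ k) u0 x)) \<le> (D * t) ^ k / fact k * M" for k
    using mult_left_mono[OF mass[OF F, of k], where c = "t ^ k / fact k"] t
    by (simp add: sum_distrib_left power_mult_distrib mult_ac)
  ultimately have "(\<Sum>x\<in>F. \<mu> x * (exp (D * t) * u x t)) \<le> exp (D * t) * M"
    by (rule sums_le[rotated])
  moreover have "(\<Sum>x\<in>F. \<mu> x * (exp (D * t) * u x t)) = exp (D * t) * (\<Sum>x\<in>F. \<mu> x * u x t)"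
    by (simp add: sum_distrib_left mult_ac)
  ultimately show ?thesis
    by simp
qed

text \<open>
  Every \<open>u(z,t+s)\<close> with \<open>z\<close> in the ball bounds \<open>u(x,t)\<close> up to the factor \<open>H\<close>, and their \<open>\<mu>\<close>-weighted sum over
  the ball is at most the total mass. The factor is left abstract so that one argument serves
  graphs with and without edges.
\<close>

lemma heat_solution_ball_bound:
  assumes u: "bounded_heat_solution V E w \<mu> u0 u" and u0: "\<And>z. z \<in> V \<Longrightarrow> u0 z \<ge> 0"
    and sym: "\<And>a b. {a, b} \<in> E \<Longrightarrow> w a b = w b a"
    and M: "\<And>F. finite F \<Longrightarrow> F \<subseteq> V \<Longrightarrow> (\<Sum>x\<in>F. \<mu> x * u0 x) \<le> 1"
    and x: "x \<in> V" and t: "t > 0" and r: "r > 0" and s: "s > 0" and "H \<ge> 0"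
    and c: "c \<ge> 0" "\<And>a b. a \<in> V \<Longrightarrow> b \<in> nbrs E a \<Longrightarrow> c * \<mu> a \<le> w a b"
    and H: "\<And>d z. ((\<lambda>a b. b \<in> nbrs E a) ^^ d) x z \<Longrightarrow> real d < r \<Longrightarrow>
      exp (D * s) \<le> H * ((c * s) ^ d / fact d)"
  shows "u x t \<le> 1 / vol \<mu> (gball V E x r) * H"
proof -
  let ?B = "gball V E x r"
  have B: "finite ?B" "?B \<subseteq> V"
    using finite_gball[OF x] by (auto simp: gball_def)
  have nonneg: "u z t \<ge> 0" if "z \<in> V" "t > 0" for z t
    using heat_solution_nonneg[OF u u0] that by auto
  have compare: "u x t \<le> H * u z (t + s)" if z: "z \<in> ?B" for z
  proof -
    from z obtain d where d: "gdist E x z = enat d" "real d < r" "z \<in> V"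
      by (rule gballE)
    note walk = gdist_enat_imp_walk[OF d(1)]
    have "exp (D * s) * u x t \<le> H * ((c * s) ^ d / fact d) * u x t"
      using H[OF walk d(2)] nonneg[OF x t] by (rule mult_right_mono)
    also have "\<dots> = H * ((c * s) ^ d / fact d * u x t)"
      by simp
    also have "\<dots> \<le> H * (exp (D * s) * u z (t + s))"
      using heat_solution_walk_bound[OF heat_solution_shift[OF u t] _ c d(3) walk_sym[OF walk] s]
        nonneg t \<open>H \<ge> 0\<close> by (intro mult_left_mono) auto
    finally show ?thesis
      by (simp add: mult.left_commute)
  qed
  have "vol \<mu> ?B * u x t = (\<Sum>z\<in>?B. \<mu> z * u x t)"
    by (simp add: vol_def sum_distrib_right)
  also have "\<dots> \<le> (\<Sum>z\<in>?B. \<mu> z * (H * u z (t + s)))"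
    using compare measure_pos B by (intro sum_mono mult_left_mono) (auto intro: less_imp_le)
  also have "\<dots> = H * (\<Sum>z\<in>?B. \<mu> z * u z (t + s))"
    by (simp add: sum_distrib_left mult_ac)
  also have "\<dots> \<le> H * 1"
    using heat_solution_mass_le[OF u u0 sym M B] t s \<open>H \<ge> 0\<close> by (intro mult_left_mono) auto
  finally have "vol \<mu> ?B * u x t \<le> H" by simp
  moreover have "vol \<mu> ?B > 0"
    unfolding vol_def using B self_in_gball[OF x r] measure_pos by (intro sum_pos) auto
  ultimately show ?thesis
    by (simp add: field_simps)
qed

end

section \<open>Heat kernel estimates\<close>

text \<open>The initial value \<open>\<delta>\<^sub>y/\<mu>(y)\<close> reduces the sum that represents the solution to one term.\<close>

lemma heat_kernel_column:
  assumes p: "is_heat_kernel V E w \<mu> p" and y: "y \<in> V" and \<mu>: "\<mu> y > 0"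
  shows "bounded_heat_solution V E w \<mu> (\<lambda>z. if z = y then 1 / \<mu> y else 0) (\<lambda>x t. p t x y)"
proof -
  let ?u0 = "\<lambda>z. if z = y then 1 / \<mu> y else 0"
  have "bounded (?u0 ` V)"
    by (rule finite_imp_bounded, rule finite_subset[of _ "{1 / \<mu> y, 0}"]) auto
  then have "bounded_heat_solution V E w \<mu> ?u0 (\<lambda>x t. \<Sum>\<^sub>\<infinity>z\<in>V. \<mu> z * p t x z * ?u0 z)"
    using p by (simp add: is_heat_kernel_def)
  moreover have "(\<Sum>\<^sub>\<infinity>z\<in>V. \<mu> z * p t x z * ?u0 z) = p t x y" for x t
  proof -
    have "(\<Sum>\<^sub>\<infinity>z\<in>V. \<mu> z * p t x z * ?u0 z) = (\<Sum>\<^sub>\<infinity>z\<in>{y}. \<mu> z * p t x z * ?u0 z)"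
      using y by (intro infsum_cong_neutral) auto
    then show ?thesis
      using \<mu> by simp
  qed
  ultimately show ?thesis
    by simp
qed

theorem theorem4:
  fixes V :: "'a set" and E :: "'a set set" and w :: "'a \<Rightarrow> 'a \<Rightarrow> real" and \<mu> :: "'a \<Rightarrow> real"
    and p :: "real \<Rightarrow> 'a \<Rightarrow> 'a \<Rightarrow> real"
  assumes "weighted_graph V E w \<mu>"
    and "D_mu V E w \<mu> < \<infinity>"
    and "mu_max V \<mu> < \<infinity>"
    and "w_min V E w > 0"
    and "\<And>x y. {x, y} \<in> E \<Longrightarrow> w x y = w y x"
    and "is_heat_kernel V E w \<mu> p"
  shows "(\<forall>t>0. \<forall>x\<in>V. \<forall>y\<in>V.
            p t x y \<le> 1 / vol \<mu> (gball V E x (sqrt t)) *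
              exp (4 * sqrt (2 * real_of_ereal (D_mu V E w \<mu>) * real_of_ereal (mu_max V \<mu>)
                              / real_of_ereal (w_min V E w) * t)))
       \<and> ((\<forall>x\<in>V. \<mu> x = wdeg E w x) \<longrightarrow>
          (\<forall>t>0. \<forall>x\<in>V. \<forall>y\<in>V.
            p t x y \<ge> (if gdist E x y = \<infinity> then 0
              else 1 / wdeg E w y *
                exp (- 2 * t - 4 * real_of_ereal (mu_max V \<mu>) / real_of_ereal (w_min V E w)
                               * ((real (the_enat (gdist E x y)))\<^sup>2 / t)))))"
proof -
  interpret weighted_graph V E w \<mu> by fact
  let ?D = "real_of_ereal (D_mu V E w \<mu>)" and ?M = "real_of_ereal (mu_max V \<mu>)"
    and ?W = "real_of_ereal (w_min V E w)"
  have D: "wdeg E w x \<le> ?D * \<mu> x" if x: "x \<in> V" for x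
  proof -
    have le: "ereal (wdeg E w x / \<mu> x) \<le> D_mu V E w \<mu>"
      unfolding D_mu_def using x by (rule SUP_upper)
    then have "wdeg E w x / \<mu> x \<le> ?D"
      using assms(2) by (cases "D_mu V E w \<mu>") auto
    then show ?thesis
      using measure_pos[OF x] by (simp add: divide_simps)
  qed
  have M: "\<mu> x \<le> ?M" if x: "x \<in> V" for x
  proof -
    have "ereal (\<mu> x) \<le> mu_max V \<mu>"
      unfolding mu_max_def using x by (rule SUP_upper)
    then show ?thesis
      using assms(3) by (cases "mu_max V \<mu>") auto
  qed
  have W: "?W > 0 \<and> ?W \<le> w x y" if "x \<in> V" "y \<in> nbrs E x" for x y
  proof -
    have "w_min V E w \<le> ereal (w x y)"
      unfolding w_min_def using that by (intro INF_lower2[of "(x, y)"]) auto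
    then show ?thesis
      using assms(4) by (cases "w_min V E w") auto
  qed
  define c where "c = ?W / ?M"
  have c: "c * \<mu> a \<le> w a b" if ab: "a \<in> V" "b \<in> nbrs E a" for a b
  proof -
    have "c * \<mu> a \<le> c * ?M"
      using M[OF ab(1)] measure_pos[OF ab(1)] W[OF ab] unfolding c_def
      by (intro mult_left_mono) auto
    also have "\<dots> \<le> w a b"
      using M[OF ab(1)] measure_pos[OF ab(1)] W[OF ab] unfolding c_def by simp
    finally show ?thesis .
  qed
  have c_pos: "c > 0" if "a \<in> V" "b \<in> nbrs E a" for a b
    using M[OF that(1)] measure_pos[OF that(1)] W[OF that] by (simp add: c_def)
  have initial_nonneg: "(if z = y then 1 / \<mu> y else 0) \<ge> 0" if "y \<in> V" for y z
    using measure_pos[OF that] by auto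
  have upper: "p t x y \<le> 1 / vol \<mu> (gball V E x (sqrt t)) * exp (4 * sqrt (2 * ?D * ?M / ?W * t))"
    if t: "t > 0" and x: "x \<in> V" and y: "y \<in> V" for t x y
  proof -
    have "wdeg E w x \<ge> 0"
      unfolding wdeg_def using weight_pos by (intro sum_nonneg) (auto simp: nbrs_def less_imp_le)
    with D[OF x] have "?D \<ge> 0"
      using measure_pos[OF x] by (metis dual_order.trans not_less zero_le_mult_iff)
    then interpret bounded_degree_graph V E w \<mu> ?D
      using D by unfold_locales
    have mass: "(\<Sum>z\<in>F. \<mu> z * (if z = y then 1 / \<mu> y else 0)) \<le> 1"
      if "finite F" "F \<subseteq> V" for F
      using that(1) measure_pos[OF y] by (simp add: if_distrib[of "\<lambda>r. _ * r"] sum.delta cong: if_cong)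
    have bound: "p t x y \<le> 1 / vol \<mu> (gball V E x (sqrt t)) * H"
      if "s > 0" "H \<ge> 0" "c' \<ge> 0" "\<And>a b. a \<in> V \<Longrightarrow> b \<in> nbrs E a \<Longrightarrow> c' * \<mu> a \<le> w a b"
        and H: "\<And>d z. ((\<lambda>a b. b \<in> nbrs E a) ^^ d) x z \<Longrightarrow> real d < sqrt t \<Longrightarrow>
          exp (?D * s) \<le> H * ((c' * s) ^ d / fact d)"
      for s H c'
    proof (rule heat_solution_ball_bound[where s = s and c = c' and u = "\<lambda>x t. p t x y"
          and ?u0.0 = "\<lambda>z. if z = y then 1 / \<mu> y else 0"])
      show "bounded_heat_solution V E w \<mu> (\<lambda>z. if z = y then 1 / \<mu> y else 0) (\<lambda>x t. p t x y)"
        by (rule heat_kernel_column[OF assms(6) y measure_pos[OF y]])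
      show "(if z = y then 1 / \<mu> y else 0) \<ge> 0" for z
        by (rule initial_nonneg[OF y])
      show "sqrt t > 0"
        using t by simp
    qed (fact assms(5) mass x t that)+
    show ?thesis
    proof (cases "\<exists>a\<in>V. \<exists>b. b \<in> nbrs E a")
      case True
      then obtain a b where ab: "a \<in> V" "b \<in> nbrs E a" by blast
      have c0: "c > 0" using c_pos[OF ab] .
      have "0 < wdeg E w a"
        unfolding wdeg_def using ab locally_finite weight_pos
        by (intro sum_pos) (auto simp: nbrs_def)
      then have D0: "?D > 0"
        using D[OF ab(1)] measure_pos[OF ab(1)] by (metis order_less_le_trans zero_less_mult_pos2)
      \<comment> \<open>\<open>s\<close> is chosen to make both \<open>D s\<close> and \<open>t / (c s)\<close> equal to \<open>q\<close>.\<close>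
      define q where "q = sqrt (t * ?D / c)"
      have q: "q > 0" "q * q = t * ?D / c"
        using t c0 D0 by (auto simp: q_def)
      define s where "s = q / ?D"
      have s: "s > 0" "?D * s = q" "t / (c * s) = q"
        using q D0 c0 by (auto simp: s_def field_simps)
      have step: "exp (?D * s) \<le> exp (4 * sqrt 2 * q) * ((c * s) ^ d / fact d)"
        if "real d < sqrt t" for d
      proof -
        have "(real d)\<^sup>2 \<le> (sqrt t)\<^sup>2"
          using that by (intro power_mono) auto
        then have "(real d)\<^sup>2 \<le> t"
          using t by simp
        then have "(real d)\<^sup>2 / (c * s) \<le> q"
          using s c0 by (metis divide_right_mono less_imp_le mult_pos_pos)
        moreover have "q + q \<le> 4 * sqrt 2 * q"
        proof -
          have "sqrt 2 \<ge> 1" by simp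
          then have "2 * q \<le> (4 * sqrt 2) * q"
            using q by (intro mult_right_mono) linarith+
          then show ?thesis by simp
        qed
        ultimately have "?D * s \<le> 4 * sqrt 2 * q + - ((real d)\<^sup>2 / (c * s))"
          unfolding s(2) by linarith
        then have "exp (?D * s) \<le> exp (4 * sqrt 2 * q) * exp (- ((real d)\<^sup>2 / (c * s)))"
          unfolding exp_add[symmetric] exp_le_cancel_iff .
        also have "\<dots> \<le> exp (4 * sqrt 2 * q) * ((c * s) ^ d / fact d)"
          using exp_minus_square_le_power_over_fact[of "c * s" d] c0 s
          by (intro mult_left_mono) auto
        finally show ?thesis .
      qed
      have "sqrt 2 * q = sqrt (2 * ?D * ?M / ?W * t)"
        by (simp add: q_def c_def mult_ac flip: real_sqrt_mult)
      then have "4 * sqrt (2 * ?D * ?M / ?W * t) = 4 * sqrt 2 * q"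
        by simp
      moreover have "p t x y \<le> 1 / vol \<mu> (gball V E x (sqrt t)) * exp (4 * sqrt 2 * q)"
        using s(1) c0 by (intro bound[of s _ c] c step) auto
      ultimately show ?thesis
        by (simp only:)
    next
      case False
      \<comment> \<open>Here \<open>c = 0\<close> and \<open>D = 0\<close>; only the walk of length \<open>0\<close> remains, so any \<open>s\<close> and \<open>c\<close> will do.\<close>
      then have "D_mu V E w \<mu> = (SUP x\<in>V. 0)"
        unfolding D_mu_def by (intro SUP_cong refl) (auto simp: wdeg_def zero_ereal_def)
      then have "?D = 0"
        using x by (auto simp: SUP_constant)
      have walk: "d = 0" if "((\<lambda>a b. b \<in> nbrs E a) ^^ d) x z" for d z
        using that False x by (cases d) (auto simp del: relpowp.simps dest!: relpowp_Suc_D2)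
      have "p t x y \<le> 1 / vol \<mu> (gball V E x (sqrt t)) * 1"
      proof (rule bound[of 1 1 1])
        fix d z assume "((\<lambda>a b. b \<in> nbrs E a) ^^ d) x z"
        then show "exp (?D * 1) \<le> 1 * ((1 * 1) ^ d / fact d)"
          using walk[of d z] \<open>?D = 0\<close> by simp
      qed (use False in auto)
      also have "\<dots> \<le> 1 / vol \<mu> (gball V E x (sqrt t)) * exp (4 * sqrt (2 * ?D * ?M / ?W * t))"
        by (simp add: \<open>?D = 0\<close>)
      finally show ?thesis .
    qed
  qed
  have lower: "p t x y \<ge> (if gdist E x y = \<infinity> then 0 else 1 / wdeg E w y *
      exp (- 2 * t - 4 * ?M / ?W * ((real (the_enat (gdist E x y)))\<^sup>2 / t)))"
    if deg: "\<forall>x\<in>V. \<mu> x = wdeg E w x" and t: "t > 0" and x: "x \<in> V" and y: "y \<in> V" for t x y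
  proof -
    interpret bounded_degree_graph V E w \<mu> 1
      using deg by unfold_locales auto
    note col = heat_kernel_column[OF assms(6) y measure_pos[OF y]]
    show ?thesis
    proof (cases "gdist E x y")
      case (enat d)
      have "nbrs E x \<noteq> {}"
        using measure_pos[OF x] deg x by (auto simp: wdeg_def)
      then have c0: "c > 0" using c_pos[OF x] by blast
      have "exp (- 2 * t - 4 * ?M / ?W * ((real d)\<^sup>2 / t)) \<le> exp (- t) * exp (- ((real d)\<^sup>2 / (c * t)))"
      proof -
        have "4 * ?M / ?W * ((real d)\<^sup>2 / t) = 4 * ((real d)\<^sup>2 / (c * t))"
          by (simp add: c_def)
        moreover have "(real d)\<^sup>2 / (c * t) \<ge> 0" using c0 t by simp
        ultimately show ?thesis using t by (simp flip: exp_add)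
      qed
      also have "\<dots> \<le> exp (- t) * ((c * t) ^ d / fact d)"
        using exp_minus_square_le_power_over_fact[of "c * t" d] c0 t
          by (intro mult_left_mono) auto
      finally have "1 / \<mu> y * exp (- 2 * t - 4 * ?M / ?W * ((real d)\<^sup>2 / t))
          \<le> 1 / \<mu> y * (exp (- t) * ((c * t) ^ d / fact d))"
        using measure_pos[OF y] by (intro mult_left_mono) auto
      also have "\<dots> = exp (- t) * ((c * t) ^ d / fact d * (1 / \<mu> y))"
        by simp
      also have "\<dots> \<le> exp (- t) * (exp (1 * t) * p t x y)"
        using heat_solution_walk_bound[OF col initial_nonneg[OF y] _ c x gdist_enat_imp_walk[OF enat] t] c0
        by (intro mult_left_mono) auto
      also have "\<dots> = p t x y"
        by (simp add: exp_minus)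
      finally show ?thesis
        using enat deg y by simp
    qed (use heat_solution_nonneg[OF col initial_nonneg[OF y] x t] in auto)
  qed
  from upper lower show ?thesis
    by blast
qed

end
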